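(* Let $\varepsilon\ge 0$ and let $S_a=(X_a,X_{a0},U_a,\to_a,Y_a,H_a)$ and $S_b=(X_b,X_{b0},U_b,\to_b,Y_b,H_b)$ be two systems with $Y_a=X_a$, $H_a=1_{X_a}$, $Y_b=X_b$, $H_b=1_{X_b}$. Let $W_a\subseteq X_a$ and $W_b\subseteq X_b$. Suppose that: (i) $R_\varepsilon\subseteq X_a\times X_b$ is an $\varepsilon$-approximate alternating simulation relation from $S_a$ to $S_b$; (ii) $R_\varepsilon(W_a)\subseteq W_b$, where $R_\varepsilon(W_a)=\{x_b\in X_b : \exists x_a\in W_a,\ (x_a,x_b)\in R_\varepsilon\}$. Let $(S^*_{ca},\mathcal{F}^*_a)\in\mathcal{R}(S_a,W_a)$ be a time-optimal controller pair for $(S_a,W_a)$ and let $(S^*_{cb},\mathcal{F}^*_b)\in\mathcal{R}(S_b,W_b)$ be a time-optimal controller pair for $(S_b,W_b)$. Then for all $x_{a0}\in X_{a0}$ and $x_{b0}\in X_{b0}$, $$(x_{a0},x_{b0})\in R_\varepsilon\implies \tilde{J}(S^*_{ca},\mathcal{F}^*_a,S_a,W_a,x_{a0})\ \ge\ \tilde{J}(S^*_{cb},\mathcal{F}^*_b,S_b,W_b,x_{b0}).$$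
   Context: **Systems.** A system $S=(X,X_0,U,\to,Y,H)$ consists of a set of states $X$, a set of initial states $X_0\subseteq X$, a set of inputs $U$, a transition relation $\to\ \subseteq X\times U\times X$, a set of outputs $Y$, and an output map $H:X\to Y$. It is metric if $Y$ is equipped with a metric $\mathbf{d}$. Write $x\xrightarrow{u}x'$ for $(x,u,x')\in\,\to$, $\mathrm{Post}_u(x)=\{x' : x\xrightarrow{u}x'\}$, and $U(x)=\{u\in U : \mathrm{Post}_u(x)\ne\emptyset\}$. $1_X$ is the identity map on $X$. **Approximate alternating simulation.** Let $S_a,S_b$ be metric systems with $Y_a=Y_b$ (same metric $\mathbf{d}$) and $\varepsilon\ge0$. A relation $R\subseteq X_a\times X_b$ is an $\varepsilon$-approximate alternating simulation relation from $S_a$ to $S_b$ if: (1) for every $x_{a0}\in X_{a0}$ there is $x_{b0}\in X_{b0}$ with $(x_{a0},x_{b0})\in R$; (2) $(x_a,x_b)\in R$ implies $\mathbf{d}(H_a(x_a),H_b(x_b))\le\varepsilon$; (3) for every $(x_a,x_b)\in R$ and every $u_a\in U_a(x_a)$ there is $u_b\in U_b(x_b)$ such that for every $x_b'\in\mathrm{Post}_{u_b}(x_b)$ there is $x_a'\in\mathrm{Post}_{u_a}(x_a)$ with $(x_a',x_b')\in R$. It is called exact if $\varepsilon=0$. Any statement that such a relation exists presupposes that the systems are metric with a common output set. **Extended relation.** For an alternating simulation relation $R$ from $S_a$ to $S_b$, $R^e\subseteq X_a\times X_b\times U_a\times U_b$ is the set of quadruples $(x_a,x_b,u_a,u_b)$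 with $(x_a,x_b)\in R$, $u_a\in U_a(x_a)$, $u_b\in U_b(x_b)$, and such that for every $x_b'\in\mathrm{Post}_{u_b}(x_b)$ there is $x_a'\in\mathrm{Post}_{u_a}(x_a)$ with $(x_a',x_b')\in R$. **Feedback composition.** Let $R$ be an exact alternating simulation relation from a system $S_c$ (the controller) to $S_a$ (the plant), with $Y_c=Y_a$, and let $\mathcal{F}=R^e$. The feedback composition $S_c\times_{\mathcal{F}}S_a$ is the system with states $X_{\mathcal{F}}=R$, initial states $X_{\mathcal{F}0}=R\cap(X_{c0}\times X_{a0})$, inputs $U_c\times U_a$, transitions $(x_c,x_a)\xrightarrow{(u_c,u_a)}(x_c',x_a')$ (between elements of $R$) iff $x_c\xrightarrow{u_c}_c x_c'$, $x_a\xrightarrow{u_a}_a x_a'$ and $(x_c,x_a,u_c,u_a)\in\mathcal{F}$, output set $Y_c=Y_a$, and output map sending $(x_c,x_a)$ to the common output $H_c(x_c)=H_a(x_a)$. **Behaviors.** A finite (resp. infinite) behavior of $S$ generated from $x\in X$ is a finite sequence $y_0y_1\dots y_n$ (resp. infinite sequence $y_0y_1\dots$) of outputs for which there are states $x_0=x,x_1,\dots$ and inputs $u_0,u_1,\dots$ with $H(x_i)=y_i$ and $x_{i-1}\xrightarrow{u_{i-1}}x_i$ for all relevant $i\ge1$. $\mathcal{B}_x(S)$ and $\mathcal{B}^\omega_x(S)$ denote the sets of finite and infinite behaviors from $x$. Write $\mathbf{y}(k)=y_k$. A behavior is maximal if there is no other behavior (from the same state) containing it as a prefix; in particular infinite behaviors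 are maximal. **Reachability.** For a system $S_a$ with $Y_a=X_a$, $H_a=1_{X_a}$ and a target $W\subseteq X_a$, $\mathcal{R}(S_a,W)$ is the set of controller pairs $(S_c,\mathcal{F})$, where $\mathcal{F}=R^e$ for an exact alternating simulation relation $R$ from $S_c$ to $S_a$, for which there is $x_0\in X_{\mathcal{F}0}$ such that every maximal behavior $\mathbf{y}\in\mathcal{B}_{x_0}(S_c\times_{\mathcal{F}}S_a)\cup\mathcal{B}^\omega_{x_0}(S_c\times_{\mathcal{F}}S_a)$ satisfies $\mathbf{y}(k)\in W$ for some $k\in\mathbb{N}$. **Entry time.** For a system $S$, a set $W$ of outputs of $S$ and $x_0\in X_0$, $J(S,W,x_0)$ is the minimum $k\in\mathbb{N}$ (with $0\in\mathbb{N}$) such that for every maximal behavior $\mathbf{y}\in\mathcal{B}_{x_0}(S)\cup\mathcal{B}^\omega_{x_0}(S)$ there is $k'\in[0,k]$ with $\mathbf{y}(k')\in W$; $J(S,W,x_0)=\infty$ if there is no such $k$. For a composition and $x_{a0}\in X_{a0}$, $$\tilde J(S_c,\mathcal{F},S_a,W,x_{a0})=\min_{x_{c0}\in X_{c0}}\{J(S_c\times_{\mathcal{F}}S_a,W,(x_{c0},x_{a0})) : (x_{c0},x_{a0})\in X_{\mathcal{F}0}\},$$ with the minimum over the empty set being $\infty$. **Time-optimal controller pair.** A pair $(S_c^*,\mathcal{F}^* )\in\mathcal{R}(S_a,W)$ is time-optimal for $(S_a,W)$ if for every $(S_c,\mathcal{F})\in\mathcal{R}(S_a,W)$ and every $x_{a0}\in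 X_{a0}$, $\tilde J(S_c,\mathcal{F},S_a,W,x_{a0})\ge\tilde J(S_c^*,\mathcal{F}^*,S_a,W,x_{a0})$. *)

theory Defs
  imports
    "HOL-Analysis.Abstract_Metric_Spaces"
    "HOL-Library.Extended_Nat"
    "HOL-Library.Infinite_Typeclass"
begin

section \<open>Systems\<close>

record ('s, 'u, 'y) system =
  states :: "'s set"
  init :: "'s set"
  inputs :: "'u set"
  transitions :: "('s \<times> 'u \<times> 's) set"
  outputs :: "'y set"
  out_map :: "'s \<Rightarrow> 'y"

definition is_system :: "('s, 'u, 'y) system \<Rightarrow> bool" where
  "is_system S \<longleftrightarrow>
     init S \<subseteq> states S \<and>
     transitions S \<subseteq> states S \<times> inputs S \<times> states S \<and>
     out_map S ` states S \<subseteq> outputs S"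

definition metric_system :: "('y \<Rightarrow> 'y \<Rightarrow> real) \<Rightarrow> ('s, 'u, 'y) system \<Rightarrow> bool" where
  "metric_system d S \<longleftrightarrow> is_system S \<and> Metric_space (outputs S) d"

definition Post :: "('s, 'u, 'y) system \<Rightarrow> 'u \<Rightarrow> 's \<Rightarrow> 's set" where
  "Post S u x = {x'. (x, u, x') \<in> transitions S}"

definition enabled :: "('s, 'u, 'y) system \<Rightarrow> 's \<Rightarrow> 'u set" where
  "enabled S x = {u \<in> inputs S. Post S u x \<noteq> {}}"

definition state_output :: "('s, 'u, 's) system \<Rightarrow> bool" where
  "state_output S \<longleftrightarrow> outputs S = states S \<and> (\<forall>x\<in>states S. out_map S x = x)"


section \<open>Alternating simulation and feedback composition\<close>

definition alt_sim ::
  "('y \<Rightarrow> 'y \<Rightarrow> real) \<Rightarrow> real \<Rightarrow> ('s, 'u, 'y) system \<Rightarrow> ('t, 'v, 'y) system \<Rightarrow> ('s \<times> 't) set \<Rightarrow> bool"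
where
  "alt_sim d \<epsilon> Sa Sb R \<longleftrightarrow>
     metric_system d Sa \<and> metric_system d Sb \<and> outputs Sa = outputs Sb \<and>
     R \<subseteq> states Sa \<times> states Sb \<and>
     (\<forall>xa0\<in>init Sa. \<exists>xb0\<in>init Sb. (xa0, xb0) \<in> R) \<and>
     (\<forall>(xa, xb)\<in>R. d (out_map Sa xa) (out_map Sb xb) \<le> \<epsilon>) \<and>
     (\<forall>(xa, xb)\<in>R. \<forall>ua\<in>enabled Sa xa. \<exists>ub\<in>enabled Sb xb.
        \<forall>xb'\<in>Post Sb ub xb. \<exists>xa'\<in>Post Sa ua xa. (xa', xb') \<in> R)"

definition extended_rel ::
  "('s, 'u, 'y) system \<Rightarrow> ('t, 'v, 'y) system \<Rightarrow> ('s \<times> 't) set \<Rightarrow> ('s \<times> 't \<times> 'u \<times> 'v) set"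
where
  "extended_rel Sa Sb R =
     {(xa, xb, ua, ub). (xa, xb) \<in> R \<and> ua \<in> enabled Sa xa \<and> ub \<in> enabled Sb xb \<and>
        (\<forall>xb'\<in>Post Sb ub xb. \<exists>xa'\<in>Post Sa ua xa. (xa', xb') \<in> R)}"

text \<open>
  The composition is indexed by the relation \<open>R\<close> rather than by \<open>\<F> = R\<^sup>e\<close>: its state set is
  \<open>R\<close>, and \<open>R\<close> cannot be recovered from \<open>R\<^sup>e\<close>, since pairs at which the controller blocks
  do not occur in \<open>R\<^sup>e\<close>.  Accordingly, a controller pair \<open>(S\<^sub>c, \<F>)\<close> is given as \<open>(S\<^sub>c, R)\<close>.
\<close>

definition feedback ::
  "('c, 'w, 'y) system \<Rightarrow> ('c \<times> 's) set \<Rightarrow> ('s, 'u, 'y) system \<Rightarrow> ('c \<times> 's, 'w \<times> 'u, 'y) system"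
where
  "feedback Sc R Sa =
     \<lparr> states = R,
       init = R \<inter> (init Sc \<times> init Sa),
       inputs = inputs Sc \<times> inputs Sa,
       transitions = {((xc, xa), (uc, ua), (xc', xa')) | xc xa uc ua xc' xa'.
          (xc, xa) \<in> R \<and> (xc', xa') \<in> R \<and>
          (xc, uc, xc') \<in> transitions Sc \<and> (xa, ua, xa') \<in> transitions Sa \<and>
          (xc, xa, uc, ua) \<in> extended_rel Sc Sa R},
       outputs = outputs Sa,
       out_map = (\<lambda>(xc, xa). out_map Sa xa) \<rparr>"

lemma out_map_feedback:
  assumes "alt_sim d 0 Sc Sa R" and "(xc, xa) \<in> R"
  shows "out_map (feedback Sc R Sa) (xc, xa) = out_map Sc xc"
    and "out_map (feedback Sc R Sa) (xc, xa) = out_map Sa xa"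
proof -
  from assms(1) have ms: "Metric_space (outputs Sa) d" and eq: "outputs Sc = outputs Sa"
    and sub: "R \<subseteq> states Sc \<times> states Sa"
    and c: "out_map Sc ` states Sc \<subseteq> outputs Sc" and a: "out_map Sa ` states Sa \<subseteq> outputs Sa"
    and le: "\<forall>(xa, xb)\<in>R. d (out_map Sc xa) (out_map Sa xb) \<le> 0"
    unfolding alt_sim_def metric_system_def is_system_def by blast+
  have "xc \<in> states Sc" "xa \<in> states Sa" using sub assms(2) by blast+
  then have "out_map Sc xc \<in> outputs Sa" "out_map Sa xa \<in> outputs Sa" using a c eq by blast+
  moreover have "d (out_map Sc xc) (out_map Sa xa) \<le> 0" using le assms(2) by blast
  then have "d (out_map Sc xc) (out_map Sa xa) = 0"
    using Metric_space.nonneg[OF ms] by (intro antisym)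
  ultimately have "out_map Sc xc = out_map Sa xa"
    using Metric_space.zero[OF ms] by blast
  then show "out_map (feedback Sc R Sa) (xc, xa) = out_map Sc xc"
    and "out_map (feedback Sc R Sa) (xc, xa) = out_map Sa xa"
    by (simp_all add: feedback_def)
qed


section \<open>Behaviors\<close>

datatype 'y behavior = FinBeh "'y list" | InfBeh "nat \<Rightarrow> 'y"

fun beh_length :: "'y behavior \<Rightarrow> enat" where
  "beh_length (FinBeh ys) = enat (length ys)"
| "beh_length (InfBeh f) = \<infinity>"

text \<open>Only meaningful for \<open>k < beh_length y\<close>.\<close>

fun beh_nth :: "'y behavior \<Rightarrow> nat \<Rightarrow> 'y" where
  "beh_nth (FinBeh ys) k = ys ! k"
| "beh_nth (InfBeh f) k = f k"

definition beh_prefix :: "'y behavior \<Rightarrow> 'y behavior \<Rightarrow> bool" where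
  "beh_prefix y z \<longleftrightarrow>
     beh_length y \<le> beh_length z \<and> (\<forall>k. enat k < beh_length y \<longrightarrow> beh_nth y k = beh_nth z k)"

definition fin_behaviors :: "('s, 'u, 'y) system \<Rightarrow> 's \<Rightarrow> 'y list set" where
  "fin_behaviors S x =
     {map (out_map S) xs | xs. xs \<noteq> [] \<and> hd xs = x \<and> set xs \<subseteq> states S \<and>
        (\<forall>i. Suc i < length xs \<longrightarrow> (\<exists>u. (xs ! i, u, xs ! Suc i) \<in> transitions S))}"

definition inf_behaviors :: "('s, 'u, 'y) system \<Rightarrow> 's \<Rightarrow> (nat \<Rightarrow> 'y) set" where
  "inf_behaviors S x =
     {out_map S \<circ> xs | xs. xs 0 = x \<and> range xs \<subseteq> states S \<and>
        (\<forall>i. \<exists>u. (xs i, u, xs (Suc i)) \<in> transitions S)}"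

definition behaviors :: "('s, 'u, 'y) system \<Rightarrow> 's \<Rightarrow> 'y behavior set" where
  "behaviors S x = FinBeh ` fin_behaviors S x \<union> InfBeh ` inf_behaviors S x"

definition maximal_behaviors :: "('s, 'u, 'y) system \<Rightarrow> 's \<Rightarrow> 'y behavior set" where
  "maximal_behaviors S x =
     {y \<in> behaviors S x. \<not> (\<exists>z\<in>behaviors S x. z \<noteq> y \<and> beh_prefix y z)}"

lemma infinite_behaviors_maximal:
  assumes "f \<in> inf_behaviors S x"
  shows "InfBeh f \<in> maximal_behaviors S x"
proof -
  have "z = InfBeh f" if "beh_prefix (InfBeh f) z" for z
  proof (cases z)
    case (FinBeh ys)
    with that show ?thesis by (simp add: beh_prefix_def)
  next
    case (InfBeh g)
    with that have "f k = g k" for k by (simp add: beh_prefix_def)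
    then have "f = g" by (rule ext)
    with InfBeh show ?thesis by (simp only:)
  qed
  moreover have "InfBeh f \<in> behaviors S x" using assms unfolding behaviors_def by blast
  ultimately show ?thesis unfolding maximal_behaviors_def by blast
qed


section \<open>Reachability and time-optimality\<close>

text \<open>
  All controllers in \<open>reach_pairs d Sa W\<close> have their states in the type \<open>'s\<close> of the plant states,
  which therefore plays the role of the universe from which state sets are drawn.  The sort
  constraint makes the universe closed under the usual finitary constructions up to bijection
  (\<open>'s \<times> 's\<close>, \<open>nat \<times> 's\<close>, \<open>'s list\<close>), so that controllers may carry memory; the state
  sets themselves are arbitrary subsets and may be finite.
\<close>

definition reach_pairs ::
  "('s \<Rightarrow> 's \<Rightarrow> real) \<Rightarrow> ('s::infinite, 'u, 's) system \<Rightarrow> 's set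
     \<Rightarrow> (('s, 'w, 's) system \<times> ('s \<times> 's) set) set"
where
  "reach_pairs d Sa W =
     {(Sc, R). alt_sim d 0 Sc Sa R \<and>
        (\<exists>x0\<in>init (feedback Sc R Sa). \<forall>y\<in>maximal_behaviors (feedback Sc R Sa) x0.
           \<exists>k. enat k < beh_length y \<and> beh_nth y k \<in> W)}"

definition reached_within :: "('s, 'u, 'y) system \<Rightarrow> 'y set \<Rightarrow> 's \<Rightarrow> nat \<Rightarrow> bool" where
  "reached_within S W x k \<longleftrightarrow>
     (\<forall>y\<in>maximal_behaviors S x. \<exists>k'\<le>k. enat k' < beh_length y \<and> beh_nth y k' \<in> W)"

definition entry_time :: "('s, 'u, 'y) system \<Rightarrow> 'y set \<Rightarrow> 's \<Rightarrow> enat" where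
  "entry_time S W x =
     (if \<exists>k. reached_within S W x k then enat (LEAST k. reached_within S W x k) else \<infinity>)"

text \<open>
  As \<^typ>\<open>enat\<close> is well-ordered with top element \<open>\<infinity>\<close>, the infimum is the minimum when the index
  set is nonempty, and \<open>\<infinity>\<close> otherwise.
\<close>

definition best_entry_time ::
  "('c, 'w, 'y) system \<Rightarrow> ('c \<times> 's) set \<Rightarrow> ('s, 'u, 'y) system \<Rightarrow> 'y set \<Rightarrow> 's \<Rightarrow> enat"
where
  "best_entry_time Sc R Sa W xa0 =
     (INF xc0 \<in> {xc0 \<in> init Sc. (xc0, xa0) \<in> init (feedback Sc R Sa)}.
        entry_time (feedback Sc R Sa) W (xc0, xa0))"

definition time_optimal ::
  "('s \<Rightarrow> 's \<Rightarrow> real) \<Rightarrow> ('s::infinite, 'u, 's) system \<Rightarrow> 's set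
     \<Rightarrow> ('s, 'w, 's) system \<Rightarrow> ('s \<times> 's) set \<Rightarrow> bool"
where
  "time_optimal d Sa W Sc' R' \<longleftrightarrow>
     (Sc', R') \<in> reach_pairs d Sa W \<and>
     (\<forall>(Sc, R) \<in> (reach_pairs d Sa W :: (('s, 'w, 's) system \<times> ('s \<times> 's) set) set).
        \<forall>xa0\<in>init Sa. best_entry_time Sc R Sa W xa0 \<ge> best_entry_time Sc' R' Sa W xa0)"

end

theory Submission
  imports Defs
begin

text \<open>
  Whether some controller reaches \<open>W\<close> from \<open>x\<close> within \<open>k\<close> steps depends on the plant alone:
  it holds iff \<open>x\<close> lies in the \<open>k\<close>-step attractor of \<open>W \<union> N\<close>, where \<open>N\<close> is the set of states
  from which blocking can be avoided forever.  The set \<open>N\<close> enters because only maximal behaviors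
  are constrained: a controller with unbounded nondeterminism may admit plays of every finite
  length but no infinite one, and then, if none of these plays is maximal, every target is reached
  vacuously.  Alternating simulations map attractors into attractors, which gives the claim.
\<close>

section \<open>Controllable predecessors, attractors, and their transport along alternating
  simulations\<close>

definition cpre :: "('s, 'u, 'y) system \<Rightarrow> 's set \<Rightarrow> 's set" where
  "cpre S X = {x. \<exists>u\<in>enabled S x. Post S u x \<subseteq> X}"

lemma mono_cpre: "mono (cpre S)"
  by (rule monoI) (auto simp: cpre_def)

text \<open>As a greatest fixed point it comes with coinduction: a set lies in it as soon as each of
  its states has an enabled input that keeps all successors in the set.\<close>

definition nonblocking :: "('s, 'u, 'y) system \<Rightarrow> 's set" where
  "nonblocking S = gfp (cpre S)"

lemma nonblocking_cpre: "nonblocking S = cpre S (nonblocking S)"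
  unfolding nonblocking_def by (rule gfp_unfold[OF mono_cpre])

primrec attr :: "('s, 'u, 'y) system \<Rightarrow> 's set \<Rightarrow> nat \<Rightarrow> 's set" where
  "attr S W 0 = W \<union> nonblocking S"
| "attr S W (Suc k) = attr S W k \<union> cpre S (attr S W k)"

lemma attr_superset: "W \<union> nonblocking S \<subseteq> attr S W k"
  by (induction k) auto

lemma attr_mono: "j \<le> k \<Longrightarrow> attr S W j \<subseteq> attr S W k"
  by (rule lift_Suc_mono_le) auto

text \<open>Let \<open>ub\<close> answer the input \<open>ua\<close> that forces \<open>X\<close>.
  Every \<open>ub\<close>-successor is related to some \<open>ua\<close>-successor, hence to an
  element of \<open>X\<close>, and so lies in \<open>Y\<close>.\<close>

lemma cpre_alt_sim:
  assumes "alt_sim d \<epsilon> Sa Sb R" and "R `` X \<subseteq> Y"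
  shows "R `` cpre Sa X \<subseteq> cpre Sb Y"
proof
  fix xb assume "xb \<in> R `` cpre Sa X"
  then obtain xa ua where "(xa, xb) \<in> R" and ua: "ua \<in> enabled Sa xa" "Post Sa ua xa \<subseteq> X"
    by (auto simp: cpre_def)
  with assms(1) obtain ub where "ub \<in> enabled Sb xb"
    "\<forall>xb'\<in>Post Sb ub xb. \<exists>xa'\<in>Post Sa ua xa. (xa', xb') \<in> R"
    unfolding alt_sim_def by blast
  with ua assms(2) show "xb \<in> cpre Sb Y" unfolding cpre_def by blast
qed

text \<open>By \<open>cpre_alt_sim\<close> with \<open>Y\<close> the image of \<open>X\<close>
  itself, the image of \<open>nonblocking Sa\<close> is a post-fixed point of
  \<open>cpre Sb\<close>; coinduction finishes.\<close>

lemma nonblocking_alt_sim: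
  assumes "alt_sim d \<epsilon> Sa Sb R"
  shows "R `` nonblocking Sa \<subseteq> nonblocking Sb"
proof -
  have "R `` nonblocking Sa \<subseteq> cpre Sb (R `` nonblocking Sa)"
    using cpre_alt_sim[OF assms order_refl, of "nonblocking Sa"] nonblocking_cpre[of Sa] by simp
  then show ?thesis unfolding nonblocking_def[of Sb] by (rule gfp_upperbound)
qed

lemma attr_alt_sim:
  assumes "alt_sim d \<epsilon> Sa Sb R" and "R `` Wa \<subseteq> Wb"
  shows "R `` attr Sa Wa k \<subseteq> attr Sb Wb k"
proof (induction k)
  case 0
  show ?case using assms(2) nonblocking_alt_sim[OF assms(1)] by auto
next
  case (Suc k)
  show ?case using Suc cpre_alt_sim[OF assms(1) Suc] by auto
qed

section \<open>Finite behaviors\<close>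

definition step :: "('s, 'u, 'y) system \<Rightarrow> 's \<Rightarrow> 's \<Rightarrow> bool" where
  "step S x x' \<longleftrightarrow> (\<exists>u. (x, u, x') \<in> transitions S)"

lemma fin_behaviors_iff:
  "ys \<in> fin_behaviors S x \<longleftrightarrow>
     (\<exists>xs. ys = map (out_map S) xs \<and> xs \<noteq> [] \<and> hd xs = x \<and> set xs \<subseteq> states S \<and> successively (step S) xs)"
  by (auto simp: fin_behaviors_def successively_conv_nth step_def)

lemma fin_behaviors_not_Nil: "ys \<in> fin_behaviors S x \<Longrightarrow> ys \<noteq> []"
  by (auto simp: fin_behaviors_iff)

lemma fin_behaviors_appendD:
  assumes "ys @ zs \<in> fin_behaviors S x" and "ys \<noteq> []"
  shows "ys \<in> fin_behaviors S x"
proof -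
  obtain xs where xs: "ys @ zs = map (out_map S) xs" "hd xs = x" "set xs \<subseteq> states S"
    "successively (step S) xs"
    using assms(1) by (auto simp: fin_behaviors_iff)
  from xs(1) obtain us vs where "xs = us @ vs" "ys = map (out_map S) us"
    by (metis append_eq_map_conv)
  with xs assms(2) show ?thesis
    by (auto simp: fin_behaviors_iff successively_append_iff)
qed

lemma inf_behaviors_prefix:
  assumes "f \<in> inf_behaviors S x"
  shows "map f [0..<Suc n] \<in> fin_behaviors S x"
proof -
  obtain xs where xs: "f = out_map S \<circ> xs" "xs 0 = x" "range xs \<subseteq> states S" "\<And>i. step S (xs i) (xs (Suc i))"
    using assms by (auto simp: inf_behaviors_def step_def)
  have "map f [0..<Suc n] = map (out_map S) (map xs [0..<Suc n])" using xs(1) by simp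
  moreover have "hd (map xs [0..<Suc n]) = x" using xs(2) by (simp add: hd_map del: upt_Suc)
  moreover have "successively (step S) (map xs [0..<Suc n])"
    using xs(4) by (simp add: successively_conv_nth del: upt_Suc)
  ultimately show ?thesis unfolding fin_behaviors_iff using xs(3)
    by (intro exI[of _ "map xs [0..<Suc n]"]) auto
qed

lemma beh_prefix_snoc: "beh_prefix (FinBeh ys) (FinBeh (ys @ [y]))"
  by (simp add: beh_prefix_def nth_append)

text \<open>A proper extension, finite or infinite, is cut off one output after \<open>ys\<close>.
  Only outputs are compared: the run behind the extension need not continue a given run behind
  \<open>ys\<close>.\<close>

lemma nonmaximal_extend:
  assumes ys: "ys \<in> fin_behaviors S x" and "FinBeh ys \<notin> maximal_behaviors S x"
  obtains y where "ys @ [y] \<in> fin_behaviors S x"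
proof -
  obtain z where z: "z \<in> behaviors S x" "z \<noteq> FinBeh ys" "beh_prefix (FinBeh ys) z"
    using assms by (auto simp: maximal_behaviors_def behaviors_def)
  show ?thesis
  proof (cases z)
    case (FinBeh zs)
    with z have le: "length ys \<le> length zs" and "\<forall>k<length ys. ys ! k = zs ! k" and ne: "zs \<noteq> ys"
      and zs: "zs \<in> fin_behaviors S x"
      by (auto simp: beh_prefix_def behaviors_def)
    then have eq: "ys = take (length ys) zs" by (auto intro: nth_equalityI)
    with ne have "length ys < length zs" using le by (metis le_neq_implies_less take_all_iff le_refl)
    then have "zs = (ys @ [zs ! length ys]) @ drop (Suc (length ys)) zs"
      using eq by (metis append.assoc append_Cons append_Nil id_take_nth_drop)
    with zs that show ?thesis by (metis fin_behaviors_appendD snoc_eq_iff_butlast)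
  next
    case (InfBeh f)
    with z have eq: "\<forall>k<length ys. ys ! k = f k" and f: "f \<in> inf_behaviors S x"
      by (auto simp: beh_prefix_def behaviors_def)
    from eq have "map f [0..<Suc (length ys)] = ys @ [f (length ys)]"
      by (auto intro: nth_equalityI)
    with inf_behaviors_prefix[OF f, of "length ys"] that show ?thesis by simp
  qed
qed

section \<open>Bounded reachability forces membership in the attractor\<close>

lemma step_feedback_iff:
  "step (feedback Sc R S) (xc, x) (xc', x') \<longleftrightarrow>
     (\<exists>uc u. (xc, x) \<in> R \<and> (xc', x') \<in> R \<and> (xc, uc, xc') \<in> transitions Sc \<and> (x, u, x') \<in> transitions S \<and>
        (xc, x, uc, u) \<in> extended_rel Sc S R)"
  by (auto simp: step_def feedback_def)

lemma map_out_feedback: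
  assumes "alt_sim d 0 Sc S R" and "state_output S" and "set xs \<subseteq> R"
  shows "map (out_map (feedback Sc R S)) xs = map snd xs"
proof -
  have "R \<subseteq> states Sc \<times> states S" using assms(1) by (simp add: alt_sim_def)
  with assms(2,3) show ?thesis
    by (auto simp: feedback_def state_output_def split: prod.splits)
qed

lemma fin_behaviors_feedback_iff:
  assumes "alt_sim d 0 Sc S R" and "state_output S"
  shows "ys \<in> fin_behaviors (feedback Sc R S) p \<longleftrightarrow>
     (\<exists>xs. ys = map snd xs \<and> xs \<noteq> [] \<and> hd xs = p \<and> set xs \<subseteq> R \<and> successively (step (feedback Sc R S)) xs)"
proof -
  have "states (feedback Sc R S) = R" by (simp add: feedback_def)
  then show ?thesis
    unfolding fin_behaviors_iff using map_out_feedback[OF assms] by metis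
qed

text \<open>Passes from one continuation to all successors under one plant input. The run of the
  longer behavior uses some \<open>u\<close> at its last step, and by \<open>extended_rel\<close>
  the controller can follow every \<open>u\<close>-successor. The input \<open>u\<close> may depend
  on all of \<open>ys\<close>, so this yields no positional strategy.\<close>

lemma feedback_extend:
  assumes sim: "alt_sim d 0 Sc S R" and out: "state_output S"
    and ext: "ys @ [y] \<in> fin_behaviors (feedback Sc R S) p" and "ys \<noteq> []"
  shows "\<exists>u\<in>enabled S (last ys). \<forall>x'\<in>Post S u (last ys). ys @ [x'] \<in> fin_behaviors (feedback Sc R S) p"
proof -
  let ?F = "feedback Sc R S"
  obtain zs where zs: "ys @ [y] = map snd zs" "hd zs = p" "set zs \<subseteq> R" "successively (step ?F) zs"
    using ext by (auto simp: fin_behaviors_feedback_iff[OF sim out])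
  from zs(1) obtain xs q where xs: "zs = xs @ [q]" "ys = map snd xs"
    by (auto simp: append_eq_map_conv)
  with \<open>ys \<noteq> []\<close> have ne: "xs \<noteq> []" by simp
  obtain xc x where l: "last xs = (xc, x)" by fastforce
  have lys: "last ys = x" using xs(2) ne l by (simp add: last_map)
  have "step ?F (xc, x) q" using zs(4) xs(1) ne l by (simp add: successively_append_iff)
  then obtain uc u where e: "(xc, x, uc, u) \<in> extended_rel Sc S R"
    by (cases q) (auto simp: step_feedback_iff)
  have "ys @ [x'] \<in> fin_behaviors ?F p" if x': "x' \<in> Post S u x" for x'
  proof -
    obtain xc' where xc': "xc' \<in> Post Sc uc xc" "(xc', x') \<in> R"
      using e x' by (auto simp: extended_rel_def)
    have "(xc, x) \<in> R" using e by (simp add: extended_rel_def)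
    then have "step ?F (xc, x) (xc', x')"
      using e xc' x' by (auto simp: step_feedback_iff Post_def)
    then have "successively (step ?F) (xs @ [(xc', x')])"
      using zs(4) xs(1) l by (simp add: successively_append_iff)
    then show ?thesis unfolding fin_behaviors_feedback_iff[OF sim out]
      using xs zs(2,3) ne xc' by (intro exI[of _ "xs @ [(xc', x')]"]) auto
  qed
  moreover have "u \<in> enabled S x" using e by (simp add: extended_rel_def)
  ultimately show ?thesis unfolding lys by blast
qed

text \<open>A behavior that misses \<open>W\<close> up to index \<open>k\<close> cannot be maximal,
  so some plant input has all its successors as continuations. Coinduction handles such behaviors of
  length above \<open>k\<close>, and backward induction on the remaining steps handles the shorter
  ones.\<close>

lemma reached_within_imp_attr:
  assumes sim: "alt_sim d 0 Sc S R" and out: "state_output S" and R: "(xc0, x0) \<in> R"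
    and reach: "reached_within (feedback Sc R S) W (xc0, x0) k"
  shows "x0 \<in> attr S W k"
proof -
  let ?T = "fin_behaviors (feedback Sc R S) (xc0, x0)"
  \<comment> \<open>Only indices up to \<open>k\<close> count, so a behavior longer than
    \<open>k\<close> stays in \<open>avoid\<close> however it is continued. This makes
    \<open>?N\<close> below a post-fixed point.\<close>
  define avoid where "avoid ys \<longleftrightarrow> (\<forall>i\<le>k. i < length ys \<longrightarrow> ys ! i \<notin> W)" for ys
  have ext: "\<exists>u\<in>enabled S (last ys). \<forall>x'\<in>Post S u (last ys). ys @ [x'] \<in> ?T"
    if "ys \<in> ?T" "avoid ys" for ys
  proof -
    have "FinBeh ys \<notin> maximal_behaviors (feedback Sc R S) (xc0, x0)"
      using reach that(2) by (auto simp: reached_within_def avoid_def)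
    with that(1) obtain y where "ys @ [y] \<in> ?T" by (rule nonmaximal_extend)
    then show ?thesis by (rule feedback_extend[OF sim out _ fin_behaviors_not_Nil[OF that(1)]])
  qed
  let ?N = "{last ys | ys. ys \<in> ?T \<and> avoid ys \<and> k < length ys}"
  have "?N \<subseteq> cpre S ?N"
  proof
    fix x assume "x \<in> ?N"
    then obtain ys where ys: "x = last ys" "ys \<in> ?T" "avoid ys" "k < length ys" by blast
    from ext[OF ys(2,3)] obtain u where u: "u \<in> enabled S x" "\<forall>x'\<in>Post S u x. ys @ [x'] \<in> ?T"
      unfolding ys(1) by blast
    have "x' \<in> ?N" if "x' \<in> Post S u x" for x'
      using u(2) that ys(3,4) by (intro CollectI exI[of _ "ys @ [x']"]) (auto simp: avoid_def nth_append)
    with u(1) show "x \<in> cpre S ?N" unfolding cpre_def by blast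
  qed
  then have N: "?N \<subseteq> nonblocking S" unfolding nonblocking_def by (rule gfp_upperbound)
  \<comment> \<open>Here \<open>j\<close> is the number of steps left: \<open>[x0]\<close> has
    \<open>j = k\<close>, and \<open>j = 0\<close> means that the indices 0 to \<open>k\<close> are
    used up, so that the last state lies in \<open>?N\<close>.\<close>
  have main: "last ys \<in> attr S W j" if "ys \<in> ?T" "avoid ys" "length ys + j = Suc k" for ys j
    using that
  proof (induction j arbitrary: ys)
    case 0
    then have "last ys \<in> ?N" by (intro CollectI exI[of _ ys]) simp
    then have "last ys \<in> nonblocking S" by (rule subsetD[OF N])
    then show ?case by simp
  next
    case (Suc j)
    from ext[OF Suc.prems(1,2)] obtain u where u: "u \<in> enabled S (last ys)"
      "\<forall>x'\<in>Post S u (last ys). ys @ [x'] \<in> ?T" by blast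
    have "x' \<in> attr S W j" if x': "x' \<in> Post S u (last ys)" for x'
    proof (cases "x' \<in> W")
      case True
      then show ?thesis using attr_superset[of W S j] by blast
    next
      case False
      then have "avoid (ys @ [x'])" using Suc.prems(2) by (auto simp: avoid_def nth_append)
      then show ?thesis using Suc.IH[of "ys @ [x']"] u(2) x' Suc.prems(3) by simp
    qed
    with u(1) show ?case by (auto simp: cpre_def)
  qed
  show ?thesis
  proof (cases "x0 \<in> W")
    case True
    then show ?thesis using attr_superset[of W S k] by blast
  next
    case False
    have "[x0] \<in> ?T"
      unfolding fin_behaviors_feedback_iff[OF sim out]
      using R by (intro exI[of _ "[(xc0, x0)]"]) simp
    then show ?thesis using main[of "[x0]" k] False by (simp add: avoid_def)
  qed
qed

section \<open>Fuel controllers\<close>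

text \<open>
  The controller follows the positional strategy \<open>\<sigma>\<close> on \<open>G\<close> and carries a strictly decreasing
  fuel.  It starts with fuel \<open>\<infinity>\<close>, so every finite play of \<open>\<sigma>\<close> is admitted by guessing its length
  in the first step, while well-foundedness of \<^typ>\<open>enat\<close> excludes all infinite plays.
\<close>

definition fuel_controller ::
  "(enat \<times> 's \<Rightarrow> 'c) \<Rightarrow> ('s, 'u, 's) system \<Rightarrow> 's set \<Rightarrow> ('s \<Rightarrow> 'u) \<Rightarrow> 's \<Rightarrow> ('c, 'w, 's) system"
where
  "fuel_controller e S G \<sigma> x0 =
     \<lparr> states = e ` (UNIV \<times> states S),
       init = {e (\<infinity>, x0)},
       inputs = UNIV,
       transitions = {(e (c, x), w, e (c', x')) | c x w c' x'.
          x \<in> G \<and> x' \<in> Post S (\<sigma> x) x \<and> c' < c},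
       outputs = outputs S,
       out_map = snd \<circ> inv e \<rparr>"

definition fuel_rel :: "(enat \<times> 's \<Rightarrow> 'c) \<Rightarrow> ('s, 'u, 's) system \<Rightarrow> ('c \<times> 's) set" where
  "fuel_rel e S = {(e (c, x), x) | c x. x \<in> states S}"

text \<open>The injection \<open>e\<close> packs fuel and plant state into one controller state,
  because \<open>reach_pairs\<close> fixes the type of controller states. The controller blocks
  outside \<open>G\<close>, so the strategy is constrained on \<open>G\<close> only.\<close>

locale fuel =
  fixes e :: "enat \<times> 's \<Rightarrow> 'c" and d :: "'s \<Rightarrow> 's \<Rightarrow> real" and S :: "('s, 'u, 's) system"
    and G :: "'s set" and \<sigma> :: "'s \<Rightarrow> 'u" and x0 :: 's and C :: "('c, 'w, 's) system"
    and R :: "('c \<times> 's) set"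
  assumes inj: "inj e" and metric: "metric_system d S" and out: "state_output S"
    and strategy: "x \<in> G \<Longrightarrow> \<sigma> x \<in> enabled S x" and x0: "x0 \<in> init S"
    and C_def: "C = fuel_controller e S G \<sigma> x0" and R_def: "R = fuel_rel e S"
begin

lemma Post_states: "x' \<in> Post S u x \<Longrightarrow> x \<in> states S \<and> x' \<in> states S"
  using metric by (auto simp: metric_system_def is_system_def Post_def)

lemma e_eq [simp]: "e p = e q \<longleftrightarrow> p = q"
  using inj by (simp add: inj_eq)

lemma transitions_C:
  "(e (c, x), w, e (c', x')) \<in> transitions C \<longleftrightarrow> x \<in> G \<and> x' \<in> Post S (\<sigma> x) x \<and> c' < c"
  by (auto simp: C_def fuel_controller_def)

lemma in_R_iff: "(e (c, x), x') \<in> R \<longleftrightarrow> x' = x \<and> x \<in> states S"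
  by (auto simp: R_def fuel_rel_def)

text \<open>The condition \<open>c' < c\<close> does not mention the plant successor, so the fuel
  \<open>c'\<close> of one transition serves for all successors under
  \<open>\<sigma> x\<close>.\<close>

lemma strategy_simulates:
  assumes "w \<in> enabled C (e (c, x))"
  shows "\<sigma> x \<in> enabled S x \<and> (\<forall>x'\<in>Post S (\<sigma> x) x. \<exists>xc'\<in>Post C w (e (c, x)). (xc', x') \<in> R)"
proof -
  obtain xc' where "(e (c, x), w, xc') \<in> transitions C"
    using assms by (auto simp: enabled_def Post_def)
  then obtain c' where c': "x \<in> G" "c' < c"
    by (auto simp: C_def fuel_controller_def)
  then have "e (c', x') \<in> Post C w (e (c, x))" if "x' \<in> Post S (\<sigma> x) x" for x'
    using that by (simp add: Post_def[of C] transitions_C)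
  then show ?thesis using strategy[OF c'(1)] Post_states by (metis in_R_iff)
qed

lemma alt_sim_C: "alt_sim d 0 C S R"
proof -
  have sys: "is_system S" and ms: "Metric_space (outputs S) d" using metric by (auto simp: metric_system_def)
  have os: "outputs S = states S" "\<And>x. x \<in> states S \<Longrightarrow> out_map S x = x"
    using out by (auto simp: state_output_def)
  have inv: "inv e (e p) = p" for p using inj by simp
  have x0S: "x0 \<in> states S" using x0 sys by (auto simp: is_system_def)
  have C: "is_system C"
    using x0S Post_states os unfolding is_system_def
    by (auto simp: C_def fuel_controller_def inv image_iff)
  have outC: "outputs C = outputs S" by (simp add: C_def fuel_controller_def)
  show ?thesis
    unfolding alt_sim_def metric_system_def
  proof (intro conjI)
    show "R \<subseteq> states C \<times> states S"
      by (auto simp: R_def fuel_rel_def C_def fuel_controller_def)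
    show "\<forall>xa0\<in>init C. \<exists>xb0\<in>init S. (xa0, xb0) \<in> R"
      using x0 x0S by (auto simp: R_def fuel_rel_def C_def fuel_controller_def)
    show "\<forall>(xc, x)\<in>R. d (out_map C xc) (out_map S x) \<le> 0"
      using Metric_space.mdist_zero[OF ms] os
      by (auto simp: R_def fuel_rel_def C_def fuel_controller_def inv)
    show "\<forall>(xc, x)\<in>R. \<forall>w\<in>enabled C xc. \<exists>u\<in>enabled S x.
        \<forall>x'\<in>Post S u x. \<exists>xc'\<in>Post C w xc. (xc', x') \<in> R"
    proof (clarify)
      fix xc x w assume "(xc, x) \<in> R" "w \<in> enabled C xc"
      then show "\<exists>u\<in>enabled S x. \<forall>x'\<in>Post S u x. \<exists>xc'\<in>Post C w xc. (xc', x') \<in> R"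
        using strategy_simulates[of w _ x] by (fastforce simp: R_def fuel_rel_def)
    qed
  qed (use C sys ms outC in auto)
qed

lemma step_fuel_iff:
  "step (feedback C R S) (e (c, x), x) (e (c', x'), x') \<longleftrightarrow> x \<in> G \<and> x' \<in> Post S (\<sigma> x) x \<and> c' < c"
proof
  assume "step (feedback C R S) (e (c, x), x) (e (c', x'), x')"
  then show "x \<in> G \<and> x' \<in> Post S (\<sigma> x) x \<and> c' < c"
    by (auto simp: step_feedback_iff transitions_C)
next
  assume *: "x \<in> G \<and> x' \<in> Post S (\<sigma> x) x \<and> c' < c"
  then have t: "(e (c, x), w, e (c', x')) \<in> transitions C" for w by (simp add: transitions_C)
  \<comment> \<open>Transitions of \<open>C\<close> ignore their input label, so any value of the
    input type will do.\<close>
  then have w: "undefined \<in> enabled C (e (c, x))"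
    unfolding enabled_def Post_def by (auto simp: C_def fuel_controller_def)
  have "(x, \<sigma> x, x') \<in> transitions S" using * by (simp add: Post_def)
  moreover have "(e (c, x), x) \<in> R" "(e (c', x'), x') \<in> R" using * Post_states by (auto simp: in_R_iff)
  moreover have "(e (c, x), x, undefined, \<sigma> x) \<in> extended_rel C S R"
    using strategy_simulates[OF w] w calculation by (simp add: extended_rel_def)
  ultimately show "step (feedback C R S) (e (c, x), x) (e (c', x'), x')"
    using t unfolding step_feedback_iff by blast
qed

abbreviation play :: "'s \<Rightarrow> 's \<Rightarrow> bool" where
  "play x x' \<equiv> x \<in> G \<and> x' \<in> Post S (\<sigma> x) x"

lemma fueled_run:
  assumes "ys \<noteq> []" and "hd ys \<in> states S" and "successively play ys" and "enat (length ys) \<le> c"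
  shows "\<exists>xs. ys = map snd xs \<and> xs \<noteq> [] \<and> hd xs = (e (c, hd ys), hd ys) \<and> set xs \<subseteq> R \<and>
     successively (step (feedback C R S)) xs"
  using assms
proof (induction ys arbitrary: c rule: induct_list012)
  case (2 x)
  then show ?case by (intro exI[of _ "[(e (c, x), x)]"]) (simp add: in_R_iff)
next
  case (3 x y zs)
  \<comment> \<open>The fuel drops at once to the number of states still to be visited. This choice
    also covers \<open>c = \<infinity>\<close>, where subtracting one would not decrease the
    fuel.\<close>
  let ?c = "enat (length (y # zs))"
  have c: "?c < c" using 3(6) by (cases c) auto
  have xy: "play x y" using 3(5) by simp
  have "y \<in> states S" "successively play (y # zs)" using 3(5) Post_states by auto
  from 3(2)[unfolded list.sel, OF list.distinct(2) this order_refl] obtain xs where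
    xs: "y # zs = map snd xs" "xs \<noteq> []" "hd xs = (e (?c, y), y)" "set xs \<subseteq> R"
    "successively (step (feedback C R S)) xs"
    by (elim exE conjE) (rule that)
  have "step (feedback C R S) (e (c, x), x) (hd xs)"
    unfolding xs(3) step_fuel_iff using xy c by blast
  moreover have "(e (c, x), x) \<in> R" using 3(4) by (simp add: in_R_iff)
  ultimately show ?case using xs
    by (intro exI[of _ "(e (c, x), x) # xs"]) (simp add: successively_Cons)
qed simp

text \<open>Outputs hide the fuel, and \<infinity> exceeds the length of every finite play, so no
  finite play of the strategy is lost.\<close>

lemma fin_behaviors_fuel_iff:
  "ys \<in> fin_behaviors (feedback C R S) (e (\<infinity>, x0), x0) \<longleftrightarrow> ys \<noteq> [] \<and> hd ys = x0 \<and> successively play ys"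
proof
  assume "ys \<in> fin_behaviors (feedback C R S) (e (\<infinity>, x0), x0)"
  then obtain xs where xs: "ys = map snd xs" "xs \<noteq> []" "hd xs = (e (\<infinity>, x0), x0)" "set xs \<subseteq> R"
    "successively (step (feedback C R S)) xs"
    unfolding fin_behaviors_feedback_iff[OF alt_sim_C out] by blast
  have "play (snd p) (snd q)" if pq: "p \<in> R" "q \<in> R" "step (feedback C R S) p q" for p q
  proof -
    obtain c x c' x' where "p = (e (c, x), x)" "q = (e (c', x'), x')"
      using pq(1,2) by (auto simp: R_def fuel_rel_def)
    with pq(3) show ?thesis by (simp add: step_fuel_iff)
  qed
  then have "successively (\<lambda>p q. play (snd p) (snd q)) xs"
    using xs(4) by (intro successively_mono[OF xs(5)]) blast
  with xs show "ys \<noteq> [] \<and> hd ys = x0 \<and> successively play ys"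
    by (simp add: successively_map hd_map)
next
  assume "ys \<noteq> [] \<and> hd ys = x0 \<and> successively play ys"
  moreover have "x0 \<in> states S" using x0 metric by (auto simp: metric_system_def is_system_def)
  ultimately show "ys \<in> fin_behaviors (feedback C R S) (e (\<infinity>, x0), x0)"
    unfolding fin_behaviors_feedback_iff[OF alt_sim_C out] using fueled_run[of ys \<infinity>] by simp
qed

lemma inf_behaviors_fuel: "inf_behaviors (feedback C R S) p = {}"
proof (rule ccontr)
  assume "inf_behaviors (feedback C R S) p \<noteq> {}"
  then obtain xs where "range xs \<subseteq> states (feedback C R S)"
    "\<And>i. step (feedback C R S) (xs i) (xs (Suc i))"
    unfolding inf_behaviors_def step_def by blast
  then have xs: "range xs \<subseteq> R" "\<And>i. step (feedback C R S) (xs i) (xs (Suc i))"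
    by (simp_all add: feedback_def)
  have "\<exists>c. xs i = (e (c, snd (xs i)), snd (xs i))" for i
    using rangeI[of xs i, THEN subsetD[OF xs(1)]] by (auto simp: R_def fuel_rel_def)
  then obtain c where cx: "\<And>i. xs i = (e (c i, snd (xs i)), snd (xs i))" by metis
  have "c (Suc i) < c i" for i
    using xs(2)[of i] cx[of i] cx[of "Suc i"] step_fuel_iff by metis
  then show False using wf[where 'a = enat] unfolding wf_iff_no_infinite_down_chain by blast
qed

lemma maximal_behaviors_fuel:
  assumes "y \<in> maximal_behaviors (feedback C R S) (e (\<infinity>, x0), x0)"
  obtains ys where "y = FinBeh ys" "ys \<noteq> []" "hd ys = x0" "successively play ys" "last ys \<notin> G"
proof -
  let ?T = "fin_behaviors (feedback C R S) (e (\<infinity>, x0), x0)"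
  obtain ys where ys: "y = FinBeh ys" "ys \<in> ?T"
    using assms inf_behaviors_fuel by (auto simp: maximal_behaviors_def behaviors_def)
  then have T: "ys \<noteq> []" "hd ys = x0" "successively play ys" by (auto simp: fin_behaviors_fuel_iff)
  have "last ys \<notin> G"
  proof
    assume l: "last ys \<in> G"
    with strategy obtain x' where "x' \<in> Post S (\<sigma> (last ys)) (last ys)" by (fastforce simp: enabled_def)
    \<comment> \<open>The run that produced \<open>ys\<close> may have exhausted its fuel; another
      run with the same outputs starts with a larger guess and goes one step further.\<close>
    with T l have "ys @ [x'] \<in> ?T" by (simp add: fin_behaviors_fuel_iff successively_append_iff)
    with assms ys(1) beh_prefix_snoc[of ys x'] show False
      by (auto simp: maximal_behaviors_def behaviors_def)
  qed
  with that ys(1) T show ?thesis by blast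
qed

end

section \<open>Members of the attractor are reached in time\<close>

text \<open>On \<open>nonblocking S\<close> the strategy stays inside, even at states of
  \<open>W\<close>; elsewhere in the attractor off \<open>W\<close> it descends from the minimal
  rank. Minimality lets a single input serve all stages \<open>j\<close> at once, since stages
  increase with \<open>j\<close>.\<close>

lemma ex_attr_strategy:
  obtains \<sigma> where
    "\<And>x. x \<in> nonblocking S \<union> (attr S W k - W) \<Longrightarrow> \<sigma> x \<in> enabled S x"
    "\<And>x. x \<in> nonblocking S \<Longrightarrow> Post S (\<sigma> x) x \<subseteq> nonblocking S"
    "\<And>x j. x \<in> attr S W j \<Longrightarrow> x \<notin> nonblocking S \<Longrightarrow> x \<notin> W \<Longrightarrow> j \<le> k \<Longrightarrow>
       0 < j \<and> Post S (\<sigma> x) x \<subseteq> attr S W (j - 1)"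
proof -
  have ex: "\<exists>u. (x \<in> nonblocking S \<union> (attr S W k - W) \<longrightarrow> u \<in> enabled S x) \<and>
      (x \<in> nonblocking S \<longrightarrow> Post S u x \<subseteq> nonblocking S) \<and>
      (\<forall>j\<le>k. x \<in> attr S W j \<and> x \<notin> nonblocking S \<and> x \<notin> W \<longrightarrow>
         0 < j \<and> Post S u x \<subseteq> attr S W (j - 1))" for x
  proof (cases "x \<in> nonblocking S")
    case True
    then have "x \<in> cpre S (nonblocking S)" using nonblocking_cpre[of S] by simp
    then obtain u where "u \<in> enabled S x" "Post S u x \<subseteq> nonblocking S"
      by (auto simp: cpre_def)
    with True show ?thesis by (intro exI[of _ u]) simp
  next
    case nN: False
    show ?thesis
    proof (cases "x \<in> attr S W k - W")
      case True
      define r where "r = (LEAST r. x \<in> attr S W r)"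
      have r: "x \<in> attr S W r" unfolding r_def using True by (rule LeastI[OF DiffD1])
      have le: "r \<le> j" if "x \<in> attr S W j" for j unfolding r_def using that by (rule Least_le)
      from r nN True have "r \<noteq> 0" by (metis DiffE UnE attr.simps(1))
      then obtain m where m: "r = Suc m" using not0_implies_Suc by blast
      have "x \<notin> attr S W m" using le[of m] m by auto
      with r m obtain u where u: "u \<in> enabled S x" "Post S u x \<subseteq> attr S W m"
        by (auto simp: cpre_def)
      have "0 < j \<and> Post S u x \<subseteq> attr S W (j - 1)" if "x \<in> attr S W j" for j
      proof
        show "0 < j" using le[OF that] m by simp
        have "m \<le> j - 1" using le[OF that] m by simp
        from u(2) attr_mono[OF this] show "Post S u x \<subseteq> attr S W (j - 1)" by (rule subset_trans)
      qed
      with u(1) nN show ?thesis by (intro exI[of _ u]) simp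
    next
      case False
      then have "x \<notin> attr S W j" if "j \<le> k" "x \<notin> W" for j
        using attr_mono[OF that(1), of S W] that(2) by blast
      \<comment> \<open>All premises of the three requirements fail at \<open>x\<close>, so the
        input is arbitrary.\<close>
      with nN False show ?thesis by (intro exI[of _ undefined]) auto
    qed
  qed
  obtain \<sigma> where "\<forall>x. (x \<in> nonblocking S \<union> (attr S W k - W) \<longrightarrow> \<sigma> x \<in> enabled S x) \<and>
      (x \<in> nonblocking S \<longrightarrow> Post S (\<sigma> x) x \<subseteq> nonblocking S) \<and>
      (\<forall>j\<le>k. x \<in> attr S W j \<and> x \<notin> nonblocking S \<and> x \<notin> W \<longrightarrow>
         0 < j \<and> Post S (\<sigma> x) x \<subseteq> attr S W (j - 1))"
    using choice[OF allI[OF ex]] by (rule exE)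
  then show ?thesis by (intro that[of \<sigma>]) blast+
qed

text \<open>An infinite cardinal absorbs the countable factor \<open>enat\<close>. Thus a controller
  with fuel memory fits into the universe of plant states.\<close>

lemma ex_enat_prod_inj: "\<exists>e :: enat \<times> 's::infinite \<Rightarrow> 's. inj e"
proof -
  include cardinal_syntax
  have "|UNIV :: enat set| \<le>o |UNIV :: nat set|"
    by (rule card_of_ordLeqI[of to_nat]) auto
  also have "|UNIV :: nat set| \<le>o |UNIV :: 's set|"
    using infinite_UNIV infinite_iff_card_of_nat by blast
  finally have "|(UNIV :: enat set) \<times> (UNIV :: 's set)| =o |UNIV :: 's set|"
    using card_of_Times_infinite[of "UNIV :: 's set" "UNIV :: enat set"] infinite_UNIV by blast
  then show ?thesis by (auto simp: card_of_ordIso[symmetric] bij_betw_def)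
qed

text \<open>Maximal plays of the fuel controller end outside \<open>?G\<close>, hence never meet
  \<open>?N\<close>, which the strategy cannot leave. So the stage drops at every step, and the last
  state is in the attractor but not in \<open>?G\<close>, that is, in \<open>W\<close>. From
  \<open>x0\<close> in \<open>?N\<close> there is no maximal behavior at all.\<close>

lemma attr_imp_reached_within:
  fixes S :: "('s::infinite, 'u, 's) system"
  assumes metric: "metric_system d S" and out: "state_output S"
    and x0: "x0 \<in> init S" and attr: "x0 \<in> attr S W k"
  obtains C :: "('s, 'w, 's) system" and R xc0 where "alt_sim d 0 C S R"
    "xc0 \<in> init C" "(xc0, x0) \<in> init (feedback C R S)"
    "reached_within (feedback C R S) W (xc0, x0) k"
proof -
  let ?N = "nonblocking S"
  let ?G = "?N \<union> (attr S W k - W)"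
  obtain e :: "enat \<times> 's \<Rightarrow> 's" where e: "inj e" using ex_enat_prod_inj by blast
  obtain \<sigma> where \<sigma>: "\<And>x. x \<in> ?G \<Longrightarrow> \<sigma> x \<in> enabled S x"
    "\<And>x. x \<in> ?N \<Longrightarrow> Post S (\<sigma> x) x \<subseteq> ?N"
    "\<And>x j. x \<in> attr S W j \<Longrightarrow> x \<notin> ?N \<Longrightarrow> x \<notin> W \<Longrightarrow> j \<le> k \<Longrightarrow>
       0 < j \<and> Post S (\<sigma> x) x \<subseteq> attr S W (j - 1)"
    using ex_attr_strategy[of S W k] by blast
  define C :: "('s, 'w, 's) system" where "C = fuel_controller e S ?G \<sigma> x0"
  define R where "R = fuel_rel e S"
  interpret fuel e d S ?G \<sigma> x0 C R
    by unfold_locales (use e metric out \<sigma>(1) x0 C_def R_def in auto)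
  have "\<exists>k'\<le>k. enat k' < beh_length y \<and> beh_nth y k' \<in> W"
    if y: "y \<in> maximal_behaviors (feedback C R S) (e (\<infinity>, x0), x0)" for y
  proof -
    from y obtain ys where ys: "y = FinBeh ys" "ys \<noteq> []" "hd ys = x0" "successively play ys" "last ys \<notin> ?G"
      by (rule maximal_behaviors_fuel)
    define l where "l = length ys - 1"
    have len: "length ys = Suc l" using ys(2) by (simp add: l_def)
    have last: "ys ! l \<notin> ?G" using ys(2,5) by (simp add: l_def last_conv_nth)
    have stp: "play (ys ! i) (ys ! Suc i)" if "i < l" for i
      using ys(4) that by (simp add: successively_conv_nth len)
    \<comment> \<open>Backward from the last index: a visit to \<open>?N\<close> would propagate to
      the end of the play.\<close>
    have nN: "ys ! i \<notin> ?N" if "i \<le> l" for i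
      using that
    proof (induction rule: inc_induct)
      case base
      then show ?case using last by simp
    next
      case (step i)
      then show ?case using stp[of i] \<sigma>(2)[of "ys ! i"] by blast
    qed
    \<comment> \<open>The bound \<open>i \<le> k\<close> is carried along because
      \<open>k - i\<close> is truncated; \<open>0 < k - i\<close> renews it for
      \<open>Suc i\<close>.\<close>
    have inv: "i \<le> k \<and> ys ! i \<in> attr S W (k - i)" if "i \<le> l" for i
      using that
    proof (induction i)
      case 0
      then show ?case using attr ys(2,3) by (simp add: hd_conv_nth)
    next
      case (Suc i)
      then have i: "i \<le> k" "ys ! i \<in> attr S W (k - i)" by auto
      have p: "play (ys ! i) (ys ! Suc i)" using stp Suc.prems by simp
      \<comment> \<open>A play continues only from \<open>?G\<close>, and off \<open>?N\<close> this
        means from the attractor minus \<open>W\<close>.\<close>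
      then have "ys ! i \<notin> W" using nN[of i] Suc.prems by auto
      with \<sigma>(3)[OF i(2)] nN[of i] Suc.prems
      have "0 < k - i" "Post S (\<sigma> (ys ! i)) (ys ! i) \<subseteq> attr S W (k - i - 1)" by auto
      with p show ?case by auto
    qed
    from inv[of l] have "l \<le> k" "ys ! l \<in> attr S W k"
      using attr_mono[of "k - l" k S W] by auto
    with last have "ys ! l \<in> W" by auto
    with \<open>l \<le> k\<close> show ?thesis using ys(1) len by (intro exI[of _ l]) simp
  qed
  then have "reached_within (feedback C R S) W (e (\<infinity>, x0), x0) k"
    unfolding reached_within_def by blast
  moreover have "e (\<infinity>, x0) \<in> init C" by (simp add: C_def fuel_controller_def)
  moreover from this have "(e (\<infinity>, x0), x0) \<in> init (feedback C R S)"
    using x0 metric by (auto simp: feedback_def in_R_iff metric_system_def is_system_def)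
  ultimately show ?thesis using that alt_sim_C by blast
qed

section \<open>Finite bounds on entry times, and the comparison of optimal controllers\<close>

lemma entry_time_le_iff: "entry_time S W x \<le> enat k \<longleftrightarrow> reached_within S W x k"
proof
  assume "entry_time S W x \<le> enat k"
  then have ex: "\<exists>k. reached_within S W x k" and "(LEAST k. reached_within S W x k) \<le> k"
    by (auto simp: entry_time_def split: if_splits)
  moreover from ex have "reached_within S W x (LEAST k. reached_within S W x k)" by (rule LeastI_ex)
  ultimately show "reached_within S W x k" unfolding reached_within_def by (meson order_trans)
next
  assume "reached_within S W x k"
  then show "entry_time S W x \<le> enat k" by (auto simp: entry_time_def intro: Least_le)
qed

lemma best_entry_time_le_iff:
  "best_entry_time Sc R S W x \<le> enat k \<longleftrightarrow>
     (\<exists>xc\<in>init Sc. (xc, x) \<in> init (feedback Sc R S) \<and> reached_within (feedback Sc R S) W (xc, x) k)"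
    (is "_ \<longleftrightarrow> ?rhs")
proof
  assume "best_entry_time Sc R S W x \<le> enat k"
  \<comment> \<open>A strict bound on the infimum is met by some member of the index set, which
    supplies the controller state.\<close>
  then have "best_entry_time Sc R S W x < enat (Suc k)" by (simp add: le_less_trans)
  then obtain xc where xc: "xc \<in> init Sc" "(xc, x) \<in> init (feedback Sc R S)"
    and less: "entry_time (feedback Sc R S) W (xc, x) < enat (Suc k)"
    unfolding best_entry_time_def by (auto simp: Inf_less_iff)
  from less have "entry_time (feedback Sc R S) W (xc, x) \<le> enat k"
    by (cases "entry_time (feedback Sc R S) W (xc, x)") auto
  with xc show ?rhs by (auto simp: entry_time_le_iff)
next
  assume ?rhs
  then show "best_entry_time Sc R S W x \<le> enat k"
    unfolding best_entry_time_def by (auto simp: entry_time_le_iff intro: INF_lower2)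
qed

theorem lemma3p4:
  fixes \<epsilon> :: real
    and d :: "'s::infinite \<Rightarrow> 's \<Rightarrow> real"
    and Sa :: "('s, 'ua, 's) system" and Sb :: "('s, 'ub, 's) system"
    and Wa Wb :: "'s set"
    and R\<epsilon> :: "('s \<times> 's) set"
    and Sca :: "('s, 'wa, 's) system" and Ra :: "('s \<times> 's) set"
    and Scb :: "('s, 'wb, 's) system" and Rb :: "('s \<times> 's) set"
  assumes "\<epsilon> \<ge> 0"
    and "is_system Sa" and "state_output Sa"
    and "is_system Sb" and "state_output Sb"
    and "Wa \<subseteq> states Sa" and "Wb \<subseteq> states Sb"
    and "alt_sim d \<epsilon> Sa Sb R\<epsilon>"
    and "R\<epsilon> `` Wa \<subseteq> Wb"
    and "time_optimal d Sa Wa Sca Ra"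
    and "time_optimal d Sb Wb Scb Rb"
  shows "\<forall>xa0\<in>init Sa. \<forall>xb0\<in>init Sb. (xa0, xb0) \<in> R\<epsilon> \<longrightarrow>
           best_entry_time Sca Ra Sa Wa xa0 \<ge> best_entry_time Scb Rb Sb Wb xb0"
proof (intro ballI impI)
  fix xa0 xb0 assume xb0: "xb0 \<in> init Sb" and rel: "(xa0, xb0) \<in> R\<epsilon>"
  show "best_entry_time Scb Rb Sb Wb xb0 \<le> best_entry_time Sca Ra Sa Wa xa0"
  proof (cases "best_entry_time Sca Ra Sa Wa xa0")
    case (enat k)
    then obtain xc0 where "(xc0, xa0) \<in> init (feedback Sca Ra Sa)"
      and reach: "reached_within (feedback Sca Ra Sa) Wa (xc0, xa0) k"
      using best_entry_time_le_iff[of Sca Ra Sa Wa xa0 k] by auto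
    then have "(xc0, xa0) \<in> Ra" by (simp add: feedback_def)
    moreover have "alt_sim d 0 Sca Sa Ra"
      using assms(10) by (simp add: time_optimal_def reach_pairs_def)
    ultimately have "xa0 \<in> attr Sa Wa k"
      using reached_within_imp_attr[OF _ assms(3) _ reach] by blast
    then have attr: "xb0 \<in> attr Sb Wb k" using attr_alt_sim[OF assms(8,9)] rel by blast
    have "metric_system d Sb" using assms(8) by (simp add: alt_sim_def)
    \<comment> \<open>The competitor is built for this \<open>xb0\<close> and \<open>k\<close>
      alone. Its input type is free and is taken to be \<open>'wb\<close>, as the optimality of
      \<open>Scb\<close> is stated for that type.\<close>
    from attr_imp_reached_within[OF this assms(5) xb0 attr]
    obtain C :: "('s, 'wb, 's) system" and R yc0 where C: "alt_sim d 0 C Sb R" "yc0 \<in> init C"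
      "(yc0, xb0) \<in> init (feedback C R Sb)" "reached_within (feedback C R Sb) Wb (yc0, xb0) k"
      by blast
    \<comment> \<open>Reaching \<open>Wb\<close> within \<open>k\<close> from this one initial pair
      already gives membership, so optimality applies.\<close>
    then have "(C, R) \<in> reach_pairs d Sb Wb"
      unfolding reach_pairs_def reached_within_def by blast
    then have "best_entry_time Scb Rb Sb Wb xb0 \<le> best_entry_time C R Sb Wb xb0"
      using assms(11) xb0 unfolding time_optimal_def by blast
    also have "\<dots> \<le> enat k" using C(2-4) by (auto simp: best_entry_time_le_iff)
    finally show ?thesis using enat by simp
  qed simp
qed

end
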